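(* Let $n=2$, let $\psi$ be a function of $x=\{x^1,x^2\}$, and let $\gamma_0>0$ and $\omega$ be constants. Consider, in the coordinates $(x,p,z)$ of the $5$-dimensional contact manifold $(\mathcal{C},\lambda=dz-p_a\,dx^a)$, the dynamical system $$\frac{dx^a}{dt}=F^a(x),\qquad \frac{d\Delta_a}{dt}=-\frac{\partial F^b}{\partial x^a}\Delta_b-\frac{d\Gamma}{d\Delta_0}\Delta_a,\qquad \frac{d\Delta_0}{dt}=-\Gamma(\Delta_0)$$ with $$F^1(x^1,x^2)=\omega x^2,\qquad F^2(x^1,x^2)=-\omega x^1,\qquad \Gamma(\Delta_0)=\gamma_0\Delta_0 .$$ Then the flow asymptotically approaches the embedded Legendre submanifold $\mathcal{A}_\psi^{\mathcal{C}}$.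
   Context: Everything is smooth; repeated indices are summed over $1,2$. Here $\Delta_0=\psi(x)-z$ and $\Delta_a=\frac{\partial\psi}{\partial x^a}(x)-p_a$, so that the system is a system of ODEs for $(x,p,z)$ (it is the flow of the contact Hamiltonian vector field of $h=\Delta_aF^a+\Gamma(\Delta_0)$). The embedded Legendre submanifold generated by $\psi$ is $\mathcal{A}_\psi^{\mathcal{C}}=\{\Delta_0=\Delta_1=\Delta_2=0\}=\{p_a=\partial\psi/\partial x^a,\ z=\psi(x)\}$. "The flow asymptotically approaches $\mathcal{A}_\psi^{\mathcal{C}}$" means that along every solution $(x(t),p(t),z(t))$, $t\ge0$, one has $\lim_{t\to\infty}\Delta_0(t)=\lim_{t\to\infty}\Delta_1(t)=\lim_{t\to\infty}\Delta_2(t)=0$. *)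

theory Defs
  imports "HOL-Analysis.Analysis"
begin

definition partial :: "'n::finite \<Rightarrow> (real ^ 'n \<Rightarrow> real) \<Rightarrow> real ^ 'n \<Rightarrow> real" where
  "partial a f x = deriv (\<lambda>s. f (x + s *\<^sub>R axis a 1)) 0"

text \<open>Functions of class \<open>C\<^sup>k\<close> on the whole space. Full differentiability is demanded at each
  step, so that every partial derivative occurring below is a genuine one, and not a junk value
  of \<^const>\<open>deriv\<close>.\<close>

primrec Ck :: "nat \<Rightarrow> (real ^ 'n::finite \<Rightarrow> real) \<Rightarrow> bool" where
  "Ck 0 f \<longleftrightarrow> continuous_on UNIV f"
| "Ck (Suc k) f \<longleftrightarrow> f differentiable_on UNIV \<and> (\<forall>a. Ck k (partial a f))"

definition smooth :: "(real ^ 'n::finite \<Rightarrow> real) \<Rightarrow> bool" where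
  "smooth f \<longleftrightarrow> (\<forall>k. Ck k f)"

text \<open>A point of the \<open>(2n+1)\<close>-dimensional contact manifold with contact form
  \<open>dz - p\<^sub>a dx\<^sup>a\<close> is given by its coordinates \<open>(x, p, z)\<close>.\<close>

definition Delta0 :: "(real ^ 'n::finite \<Rightarrow> real) \<Rightarrow> real ^ 'n \<Rightarrow> real \<Rightarrow> real" where
  "Delta0 \<psi> x z = \<psi> x - z"

definition Delta :: "(real ^ 'n::finite \<Rightarrow> real) \<Rightarrow> 'n \<Rightarrow> real ^ 'n \<Rightarrow> real ^ 'n \<Rightarrow> real" where
  "Delta \<psi> a x p = partial a \<psi> x - p $ a"

definition legendre_submanifold ::
  "(real ^ 'n::finite \<Rightarrow> real) \<Rightarrow> ((real ^ 'n) \<times> (real ^ 'n) \<times> real) set" where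
  "legendre_submanifold \<psi> = {(x, p, z). Delta0 \<psi> x z = 0 \<and> (\<forall>a. Delta \<psi> a x p = 0)}"

lemma legendre_submanifold_graph:
  "legendre_submanifold \<psi> = {(x, p, z). p = (\<chi> a. partial a \<psi> x) \<and> z = \<psi> x}"
  by (auto simp: legendre_submanifold_def Delta0_def Delta_def vec_eq_iff)

text \<open>The curve \<open>(x(t), p(t), z(t))\<close>, \<open>t \<ge> 0\<close>, solves the system determined by \<open>F\<close>, \<open>\<Gamma>\<close> and \<open>\<psi>\<close>.
  The derivatives of \<open>\<Delta>\<^sub>a\<close> and \<open>\<Delta>\<^sub>0\<close> are taken along the curve (one-sided at \<open>t = 0\<close>). For smooth
  \<open>\<psi>\<close> and differentiable \<open>x\<close>, their differentiability amounts to that of \<open>p\<close> and \<open>z\<close>.\<close>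

definition solves_system ::
  "(real ^ 'n::finite \<Rightarrow> real ^ 'n) \<Rightarrow> (real \<Rightarrow> real) \<Rightarrow> (real ^ 'n \<Rightarrow> real) \<Rightarrow>
   (real \<Rightarrow> real ^ 'n) \<Rightarrow> (real \<Rightarrow> real ^ 'n) \<Rightarrow> (real \<Rightarrow> real) \<Rightarrow> bool" where
  "solves_system F \<Gamma> \<psi> x p z \<longleftrightarrow>
     (\<forall>t\<ge>0.
        (x has_vector_derivative F (x t)) (at t within {0..}) \<and>
        (\<forall>a. ((\<lambda>s. Delta \<psi> a (x s) (p s)) has_real_derivative
               - (\<Sum>b\<in>UNIV. partial a (\<lambda>y. F y $ b) (x t) * Delta \<psi> b (x t) (p t))
               - deriv \<Gamma> (Delta0 \<psi> (x t) (z t)) * Delta \<psi> a (x t) (p t))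
             (at t within {0..})) \<and>
        ((\<lambda>s. Delta0 \<psi> (x s) (z s)) has_real_derivative - \<Gamma> (Delta0 \<psi> (x t) (z t)))
          (at t within {0..}))"

text \<open>The flow approaches \<^const>\<open>legendre_submanifold\<close> of \<open>\<psi>\<close> in the sense that the functions
  cutting it out tend to zero along every solution.\<close>

definition flow_approaches_legendre ::
  "(real ^ 'n::finite \<Rightarrow> real ^ 'n) \<Rightarrow> (real \<Rightarrow> real) \<Rightarrow> (real ^ 'n \<Rightarrow> real) \<Rightarrow> bool" where
  "flow_approaches_legendre F \<Gamma> \<psi> \<longleftrightarrow>
     (\<forall>x p z. solves_system F \<Gamma> \<psi> x p z \<longrightarrow>
        ((\<lambda>t. Delta0 \<psi> (x t) (z t)) \<longlongrightarrow> 0) at_top \<and>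
        (\<forall>a. ((\<lambda>t. Delta \<psi> a (x t) (p t)) \<longlongrightarrow> 0) at_top))"

end

theory Submission
  imports Defs
begin

text \<open>The Jacobian of \<open>F\<close> is antisymmetric, so the coupling between \<open>\<Delta>\<^sub>1\<close> and \<open>\<Delta>\<^sub>2\<close> is a rotation
  and cancels in the derivative of \<open>\<Delta>\<^sub>1\<^sup>2 + \<Delta>\<^sub>2\<^sup>2\<close>. This energy therefore decays exactly like
  \<open>exp (- 2 \<gamma>\<^sub>0 t)\<close>, and \<open>\<Delta>\<^sub>0\<close> decays like \<open>exp (- \<gamma>\<^sub>0 t)\<close>.\<close>

text \<open>Integrating factor: \<open>u s * exp (c * s)\<close> has zero derivative on the
  half-line, which is convex, so it keeps its value at 0. The sign of \<open>c\<close> does not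
  matter here.\<close>

lemma linear_decay_explicit:
  fixes u :: "real \<Rightarrow> real"
  assumes "\<And>t. t \<ge> 0 \<Longrightarrow> (u has_real_derivative - c * u t) (at t within {0..})"
    and "t \<ge> 0"
  shows "u t = u 0 * exp (- c * t)"
proof -
  have "((\<lambda>s. u s * exp (c * s)) has_real_derivative 0) (at s within {0..})" if "s \<in> {0..}" for s
    using that by (auto intro!: derivative_eq_intros assms(1) simp: algebra_simps)
  then have "\<exists>k. \<forall>s\<in>{0..}. u s * exp (c * s) = k"
    by (intro has_field_derivative_zero_constant convex_real_interval)
  then obtain k where k: "\<And>s. s \<in> {0..} \<Longrightarrow> u s * exp (c * s) = k"
    by blast
  have "u t * exp (c * t) = u 0"
    using k[of t] k[of 0] \<open>t \<ge> 0\<close> by simp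
  then show ?thesis
    by (simp add: exp_minus field_simps)
qed

lemma linear_decay_tendsto_0:
  fixes u :: "real \<Rightarrow> real"
  assumes "\<And>t. t \<ge> 0 \<Longrightarrow> (u has_real_derivative - c * u t) (at t within {0..})"
    and "c > 0"
  shows "(u \<longlongrightarrow> 0) at_top"
proof -
  have "filterlim (\<lambda>t. - c * t) at_bot at_top"
    using \<open>c > 0\<close> by (intro filterlim_tendsto_neg_mult_at_bot[OF tendsto_const _ filterlim_ident]) auto
  then have "((\<lambda>t. u 0 * exp (- c * t)) \<longlongrightarrow> 0) at_top"
    by (intro tendsto_mult_right_zero filterlim_compose[OF exp_at_bot])
  \<comment> \<open>The explicit formula is available only for \<open>t \<ge> 0\<close>, which is
    enough for a limit at infinity.\<close>
  moreover have "\<forall>\<^sub>F t in at_top. u 0 * exp (- c * t) = u t"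
    using eventually_ge_at_top[of 0]
    by (rule eventually_mono) (rule linear_decay_explicit[OF assms(1), symmetric])
  ultimately show ?thesis
    by (rule Lim_transform_eventually)
qed

text \<open>The square of \<open>u\<close> is squeezed between 0 and the sum.\<close>

lemma tendsto_0_if_sum_squares_tendsto_0:
  fixes u v :: "'a \<Rightarrow> real"
  assumes "((\<lambda>t. (u t)\<^sup>2 + (v t)\<^sup>2) \<longlongrightarrow> 0) A"
  shows "(u \<longlongrightarrow> 0) A"
proof -
  have "((\<lambda>t. (u t)\<^sup>2) \<longlongrightarrow> 0) A"
    by (rule tendsto_sandwich[OF _ _ tendsto_const assms]) auto
  then show ?thesis
    by simp
qed

text \<open>Along a line in direction \<open>a\<close>, coordinate \<open>b\<close> grows at unit
  rate if \<open>a = b\<close> and is constant otherwise. This yields the Jacobian of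
  \<open>F\<close>, each component of which is a multiple of one coordinate.\<close>

lemma partial_scaled_component:
  fixes x :: "real ^ 'n::finite"
  shows "partial a (\<lambda>y. c * y $ b) x = (if a = b then c else 0)"
proof -
  have "((\<lambda>s. c * (x + s *\<^sub>R axis a 1) $ b) has_real_derivative (if a = b then c else 0)) (at 0)"
    by (auto simp: axis_def intro!: derivative_eq_intros)
  then show ?thesis
    unfolding partial_def by (rule DERIV_imp_deriv)
qed

theorem theorem4p5:
  fixes \<psi> :: "real ^ 2 \<Rightarrow> real" and \<gamma>\<^sub>0 \<omega> :: real
    and F :: "real ^ 2 \<Rightarrow> real ^ 2" and \<Gamma> :: "real \<Rightarrow> real"
  assumes "smooth \<psi>"
    and "\<gamma>\<^sub>0 > 0"
    and "\<And>x. F x $ 1 = \<omega> * x $ 2"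
    and "\<And>x. F x $ 2 = - \<omega> * x $ 1"
    and "\<And>d. \<Gamma> d = \<gamma>\<^sub>0 * d"
  shows "flow_approaches_legendre F \<Gamma> \<psi>"
  unfolding flow_approaches_legendre_def
proof (intro allI impI)
  fix x p :: "real \<Rightarrow> real ^ 2" and z :: "real \<Rightarrow> real"
  assume sol: "solves_system F \<Gamma> \<psi> x p z"
  define D where "D a t = Delta \<psi> a (x t) (p t)" for a t
  \<comment> \<open>Linearity of \<open>\<Gamma>\<close> makes the damping rate constant, so the
    equations for \<open>D 1\<close> and \<open>D 2\<close> do not involve
    \<open>Delta0\<close>.\<close>
  have deriv_\<Gamma>: "deriv \<Gamma> d = \<gamma>\<^sub>0" for d
    unfolding assms(5)[abs_def] by (auto intro!: DERIV_imp_deriv derivative_eq_intros)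
  have partial_F: "partial a (\<lambda>y. F y $ 1) y = (if a = 2 then \<omega> else 0)"
    "partial a (\<lambda>y. F y $ 2) y = (if a = 1 then - \<omega> else 0)" for a y
    unfolding assms(3,4) by (rule partial_scaled_component)+
  \<comment> \<open>The sum runs over the component index of \<open>F\<close>, so \<open>D 1\<close>
    receives minus the partial derivative of \<open>F y $ 2\<close> in direction 1, namely
    \<open>\<omega>\<close>, as the coefficient of \<open>D 2\<close>.\<close>
  have D1: "(D 1 has_real_derivative \<omega> * D 2 t - \<gamma>\<^sub>0 * D 1 t) (at t within {0..})"
    and D2: "(D 2 has_real_derivative - \<omega> * D 1 t - \<gamma>\<^sub>0 * D 2 t) (at t within {0..})"
    if "t \<ge> 0" for t
  proof -
    have "(D a has_real_derivative - (\<Sum>b\<in>UNIV. partial a (\<lambda>y. F y $ b) (x t) * D b t)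
        - \<gamma>\<^sub>0 * D a t) (at t within {0..})" for a
      using sol that unfolding solves_system_def deriv_\<Gamma> D_def[abs_def] by blast
    from this[of 1] this[of 2] show
      "(D 1 has_real_derivative \<omega> * D 2 t - \<gamma>\<^sub>0 * D 1 t) (at t within {0..})"
      "(D 2 has_real_derivative - \<omega> * D 1 t - \<gamma>\<^sub>0 * D 2 t) (at t within {0..})"
      by (simp_all add: sum_2 partial_F)
  qed
  have "((\<lambda>t. (D 1 t)\<^sup>2 + (D 2 t)\<^sup>2) has_real_derivative - (2 * \<gamma>\<^sub>0) * ((D 1 t)\<^sup>2 + (D 2 t)\<^sup>2))
      (at t within {0..})" if "t \<ge> 0" for t
    \<comment> \<open>The cross terms are \<open>2 * \<omega> * D 1 t * D 2 t\<close> with opposite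
      signs; the damping terms give the rate \<open>2 * \<gamma>\<^sub>0\<close>.\<close>
    by (rule DERIV_cong[OF DERIV_add[OF DERIV_power[OF D1[OF that]] DERIV_power[OF D2[OF that]]]])
      (simp add: algebra_simps power2_eq_square)
  then have energy: "((\<lambda>t. (D 1 t)\<^sup>2 + (D 2 t)\<^sup>2) \<longlongrightarrow> 0) at_top"
    by (rule linear_decay_tendsto_0) (use \<open>\<gamma>\<^sub>0 > 0\<close> in auto)
  have "(D 1 \<longlongrightarrow> 0) at_top" "(D 2 \<longlongrightarrow> 0) at_top"
    using energy tendsto_0_if_sum_squares_tendsto_0[of "D 1" "D 2"]
      tendsto_0_if_sum_squares_tendsto_0[of "D 2" "D 1"] by (simp_all add: add.commute)
  then have "\<forall>a. (D a \<longlongrightarrow> 0) at_top"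
    by (simp add: forall_2)
  \<comment> \<open>The equation for \<open>Delta0\<close> is closed and already linear, with rate
    \<open>\<gamma>\<^sub>0\<close>.\<close>
  moreover have "((\<lambda>t. Delta0 \<psi> (x t) (z t)) \<longlongrightarrow> 0) at_top"
    using sol by (intro linear_decay_tendsto_0[OF _ \<open>\<gamma>\<^sub>0 > 0\<close>]) (simp add: solves_system_def assms(5))
  ultimately show "((\<lambda>t. Delta0 \<psi> (x t) (z t)) \<longlongrightarrow> 0) at_top \<and>
      (\<forall>a. ((\<lambda>t. Delta \<psi> a (x t) (p t)) \<longlongrightarrow> 0) at_top)"
    by (simp add: D_def[abs_def])
qed

end
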